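(* Fix an integer $r\ge 5$ and let $(G_n)$ be graphs with $t_n=\chi_{\mathrm f}(G_n)\to\infty$. Put $$A(t,p)=8\log_{1/(1-p)}(2et)+4 .$$ Let $p_n\in(0,1)$ and $R_n\ge 1$ satisfy $$R_nA(t_n,p_n)=o(t_n).$$ Then either $$\limsup_{n\to\infty}h_r^{\mathrm f}(G_n)=\infty,$$ or, for all sufficiently large $n$, $$\Pr\bigl(\rho_{<r}((G_n)_{p_n})\le R_n\bigr)\le \frac1{2t_n}.$$ Equivalently, for each $n$ for which $$\Pr\bigl(\rho_{<r}((G_n)_{p_n})\le R_n\bigr)>\frac1{2t_n},$$ one has the explicit lower bound $$h_r^{\mathrm f}(G_n)\ge \frac{t_n}{R_nA(t_n,p_n)}.$$ Consequently, if a sequence $(G_n)$ has bounded $h_r^{\mathrm f}$, then every useful thinning, namely every choice with $R_nA(t_n,p_n)=o(t_n)$, has fractional short-cycle cost $\rho_{<r}((G_n)_{p_n})$ larger than $R_n$ with probability at least $1-1/(2t_n)$ for all sufficiently large $n$.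
   Context: All graphs are finite and simple; subgraphs need not be induced. $\chi_{\mathrm f}$ is the fractional chromatic number, with $\chi_{\mathrm f}(\emptyset)=0$; the $e$ in $2et$ is Euler's number. The girth of a forest is $\infty$. For $p\in(0,1)$, $G_p$ is the random spanning subgraph of $G$ obtained by retaining each edge independently with probability $p$. $h_r^{\mathrm f}(G)=\max\{\chi_{\mathrm f}(H):H\subseteq G,\ \operatorname{girth}(H)\ge r\}$. For a graph $X$, the fractional short-cycle cost is $$\rho_{<r}(X)=\min\{\chi_{\mathrm f}((V(X),F)): F\subseteq E(X),\ X-F\text{ has girth at least }r\},$$ where $(V(X),F)$ is the graph with vertex set $V(X)$ and edge set $F$, and $X-F$ is obtained from $X$ by deleting the edges in $F$. *)

theory Defs
  imports "HOL-Probability.Probability" "HOL-Library.Landau_Symbols" "HOL-Library.Extended_Nat"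
begin

datatype 'a graph = Graph (verts: "'a set") (edges: "'a set set")

definition fin_simple_graph :: "'a graph \<Rightarrow> bool" where
  "fin_simple_graph G \<longleftrightarrow>
     finite (verts G) \<and> (\<forall>e\<in>edges G. e \<subseteq> verts G \<and> card e = 2)"

definition subgraph :: "'a graph \<Rightarrow> 'a graph \<Rightarrow> bool" where
  "subgraph H G \<longleftrightarrow>
     fin_simple_graph H \<and> verts H \<subseteq> verts G \<and> edges H \<subseteq> edges G"

definition independent_sets :: "'a graph \<Rightarrow> 'a set set" where
  "independent_sets G = {I. I \<subseteq> verts G \<and> (\<forall>u\<in>I. \<forall>v\<in>I. {u, v} \<notin> edges G)}"

definition fractional_colouring :: "'a graph \<Rightarrow> ('a set \<Rightarrow> real) \<Rightarrow> bool" where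
  "fractional_colouring G w \<longleftrightarrow>
     (\<forall>I\<in>independent_sets G. 0 \<le> w I) \<and>
     (\<forall>v\<in>verts G. 1 \<le> (\<Sum>I | I \<in> independent_sets G \<and> v \<in> I. w I))"

definition chi_f :: "'a graph \<Rightarrow> real" where
  "chi_f G = Inf {(\<Sum>I\<in>independent_sets G. w I) | w. fractional_colouring G w}"

text \<open>A cycle is given by the list of its vertices in cyclic order, without repeating
  the first vertex at the end, so its length is the length of the list.\<close>

definition is_cycle :: "'a graph \<Rightarrow> 'a list \<Rightarrow> bool" where
  "is_cycle G c \<longleftrightarrow> 3 \<le> length c \<and> distinct c \<and> set c \<subseteq> verts G \<and>
     (\<forall>i<length c. {c ! i, c ! (Suc i mod length c)} \<in> edges G)"

text \<open>The infimum of the empty set in \<^typ>\<open>enat\<close> is \<open>\<infinity>\<close>, the girth of a forest.\<close>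

definition girth :: "'a graph \<Rightarrow> enat" where
  "girth G = Inf {enat (length c) | c. is_cycle G c}"

definition h_f :: "nat \<Rightarrow> 'a graph \<Rightarrow> real" where
  "h_f r G = Max {chi_f H | H. subgraph H G \<and> enat r \<le> girth H}"

definition delete_edges :: "'a graph \<Rightarrow> 'a set set \<Rightarrow> 'a graph" where
  "delete_edges X F = Graph (verts X) (edges X - F)"

definition short_cycle_cost :: "nat \<Rightarrow> 'a graph \<Rightarrow> real" where
  "short_cycle_cost r X =
     Min {chi_f (Graph (verts X) F) | F. F \<subseteq> edges X \<and> enat r \<le> girth (delete_edges X F)}"

definition random_subgraph :: "'a graph \<Rightarrow> real \<Rightarrow> 'a graph pmf" where
  "random_subgraph G p =
     map_pmf (\<lambda>keep. Graph (verts G) {e \<in> edges G. keep e})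
       (Pi_pmf (edges G) False (\<lambda>_. bernoulli_pmf p))"

definition A_factor :: "real \<Rightarrow> real \<Rightarrow> real" where
  "A_factor t p = 8 * log (1 / (1 - p)) (2 * exp 1 * t) + 4"

end

theory Submission
  imports Defs
begin

text \<open>If the cost of a thinned graph \<open>X\<close> is at most \<open>R\<close>, deleting an optimal edge set \<open>F\<close> leaves a
  subgraph of large girth, and submultiplicativity of the fractional chromatic number under edge
  unions gives \<open>\<chi>(X) \<le> R h(G)\<close>. So it suffices that \<open>\<chi>(G\<^sub>p) \<ge> t / A\<close> up to probability
  \<open>1 / (2 t)\<close>. Take vertex weights of total almost \<open>t\<close> that give every independent set of \<open>G\<close>
  weight at most \<open>1\<close>. If \<open>\<chi>(G\<^sub>p)\<close> is small, some set \<open>S\<close> of weight at least \<open>A\<close> is independent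
  in \<open>G\<^sub>p\<close>. As \<open>G[S]\<close> has no heavy subset of small degeneracy, ordering the vertices by decreasing
  weight yields an initial segment \<open>T\<close> of \<open>S\<close> that spans many edges of \<open>G\<close> and is not too sparse
  among the vertices preceding its last element. There are few enough candidates for \<open>T\<close> to apply
  a union bound.\<close>

section \<open>Fractional colourings\<close>

lemma finite_independent_sets: "fin_simple_graph X \<Longrightarrow> finite (independent_sets X)"
  unfolding independent_sets_def fin_simple_graph_def by (auto intro: finite_subset[of _ "Pow (verts X)"])

lemma independent_setsD: "I \<in> independent_sets X \<Longrightarrow> I \<subseteq> verts X"
  by (auto simp: independent_sets_def)

lemma singleton_independent:
  assumes "fin_simple_graph X" "v \<in> verts X"
  shows "{v} \<in> independent_sets X"
proof -
  have "card {v, v} = 1" by simp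
  then show ?thesis
    using assms unfolding independent_sets_def fin_simple_graph_def by fastforce
qed

lemma fractional_colouring_total_nonneg:
  "fractional_colouring X w \<Longrightarrow> 0 \<le> (\<Sum>I\<in>independent_sets X. w I)"
  by (auto simp: fractional_colouring_def intro: sum_nonneg)

lemma chi_f_le:
  "fractional_colouring X w \<Longrightarrow> chi_f X \<le> (\<Sum>I\<in>independent_sets X. w I)"
  unfolding chi_f_def
  by (rule cInf_lower) (auto intro!: bdd_belowI[of _ 0] fractional_colouring_total_nonneg)

text \<open>Colour classes may be indexed with repetitions: the weights of all indices carrying the
  same set are added up. Products and sequences of independent sets then need no
  injectivity.\<close>

lemma chi_f_le_cover:
  assumes X: "fin_simple_graph X" and J: "finite J"
    and c: "\<And>j. j \<in> J \<Longrightarrow> 0 \<le> c j"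
    and I: "\<And>j. j \<in> J \<Longrightarrow> I j \<in> independent_sets X"
    and cover: "\<And>v. v \<in> verts X \<Longrightarrow> 1 \<le> (\<Sum>j | j \<in> J \<and> v \<in> I j. c j)"
  shows "\<exists>w. fractional_colouring X w \<and> (\<Sum>K\<in>independent_sets X. w K) = sum c J"
    and "chi_f X \<le> sum c J"
proof -
  define w where "w K = (\<Sum>j | j \<in> J \<and> I j = K. c j)" for K
  have fin: "finite (independent_sets X)" by (rule finite_independent_sets[OF X])
  have tot: "(\<Sum>K\<in>independent_sets X. w K) = sum c J"
    unfolding w_def using sum.group[OF J fin, of I c] I by auto
  have "(\<Sum>K | K \<in> independent_sets X \<and> v \<in> K. w K) = (\<Sum>j | j \<in> J \<and> v \<in> I j. c j)" for v
  proof -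
    have "(\<Sum>K | K \<in> independent_sets X \<and> v \<in> K. w K) =
        (\<Sum>K | K \<in> independent_sets X \<and> v \<in> K. \<Sum>j | j \<in> {j \<in> J. v \<in> I j} \<and> I j = K. c j)"
      unfolding w_def by (intro sum.cong) auto
    also have "\<dots> = (\<Sum>j | j \<in> J \<and> v \<in> I j. c j)"
      by (rule sum.group) (use J fin I in auto)
    finally show ?thesis .
  qed
  moreover have "0 \<le> w K" for K unfolding w_def using c by (auto intro: sum_nonneg)
  ultimately have col: "fractional_colouring X w"
    unfolding fractional_colouring_def using cover by simp
  then show "\<exists>w. fractional_colouring X w \<and> (\<Sum>K\<in>independent_sets X. w K) = sum c J"
    using tot by blast
  show "chi_f X \<le> sum c J" using chi_f_le[OF col] tot by simp
qed

text \<open>All singletons with weight 1 form a colouring, so the infimum in \<open>chi_f\<close>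
  ranges over a nonempty set.\<close>

lemma fractional_colouring_exists:
  assumes X: "fin_simple_graph X"
  shows "\<exists>w. fractional_colouring X w"
proof -
  have "{j. j \<in> verts X \<and> v \<in> {j}} = {v}" if "v \<in> verts X" for v using that by auto
  then show ?thesis
    using chi_f_le_cover(1)[OF X, of "verts X" "\<lambda>_. 1" "\<lambda>v. {v}"] X singleton_independent[OF X]
    by (force simp: fin_simple_graph_def)
qed

lemma chi_f_greatest:
  assumes "fin_simple_graph X"
    and "\<And>w. fractional_colouring X w \<Longrightarrow> s \<le> (\<Sum>I\<in>independent_sets X. w I)"
  shows "s \<le> chi_f X"
  unfolding chi_f_def by (rule cInf_greatest) (use assms fractional_colouring_exists in auto)

lemma chi_f_nonneg: "fin_simple_graph X \<Longrightarrow> 0 \<le> chi_f X"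
  by (intro chi_f_greatest fractional_colouring_total_nonneg)

lemma chi_f_ge_1:
  assumes X: "fin_simple_graph X" and v: "v \<in> verts X"
  shows "1 \<le> chi_f X"
proof (rule chi_f_greatest[OF X])
  fix w assume w: "fractional_colouring X w"
  have "1 \<le> (\<Sum>I | I \<in> independent_sets X \<and> v \<in> I. w I)"
    using w v by (auto simp: fractional_colouring_def)
  also have "\<dots> \<le> (\<Sum>I\<in>independent_sets X. w I)"
    by (rule sum_mono2) (use w finite_independent_sets[OF X] in \<open>auto simp: fractional_colouring_def\<close>)
  finally show "1 \<le> (\<Sum>I\<in>independent_sets X. w I)" .
qed

lemma chi_f_empty:
  assumes X: "fin_simple_graph X" and "verts X = {}"
  shows "chi_f X = 0"
  using chi_f_le_cover(2)[OF X, of "{}" undefined undefined] chi_f_nonneg[OF X] assms(2) by simp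

section \<open>Submultiplicativity under edge unions\<close>

lemma fin_simple_graph_delete:
  "fin_simple_graph X \<Longrightarrow> fin_simple_graph (delete_edges X F)"
  by (auto simp: fin_simple_graph_def delete_edges_def)

lemma fin_simple_graph_spanning:
  "fin_simple_graph X \<Longrightarrow> F \<subseteq> edges X \<Longrightarrow> fin_simple_graph (Graph (verts X) F)"
  by (auto simp: fin_simple_graph_def)

text \<open>Passes to the infimum in one factor of a product; the case \<open>a = 0\<close> is
  separate because the argument divides by \<open>a\<close>.\<close>

lemma le_mult_chi_f:
  assumes X: "fin_simple_graph X" and a: "0 \<le> a"
    and le: "\<And>w. fractional_colouring X w \<Longrightarrow> s \<le> a * (\<Sum>I\<in>independent_sets X. w I)"
  shows "s \<le> a * chi_f X"
proof (cases "a = 0")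
  case True
  then show ?thesis using le fractional_colouring_exists[OF X] by auto
next
  case False
  then have a: "0 < a" using a by simp
  have "s / a \<le> chi_f X"
    using chi_f_greatest[OF X, of "s / a"] le a by (simp add: field_simps)
  then show ?thesis using a by (simp add: field_simps)
qed

text \<open>Intersecting the colour classes of the two edge-disjoint parts gives a product colouring.\<close>

lemma chi_f_le_mult:
  assumes X: "fin_simple_graph X" and F: "F \<subseteq> edges X"
  shows "chi_f X \<le> chi_f (delete_edges X F) * chi_f (Graph (verts X) F)"
proof -
  let ?Y = "delete_edges X F" and ?Z = "Graph (verts X) F"
  have Y: "fin_simple_graph ?Y" and Z: "fin_simple_graph ?Z"
    using X F fin_simple_graph_delete fin_simple_graph_spanning by auto
  have key: "chi_f X \<le> (\<Sum>I\<in>independent_sets ?Y. w I) * (\<Sum>I\<in>independent_sets ?Z. w' I)"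
    if w: "fractional_colouring ?Y w" and w': "fractional_colouring ?Z w'" for w w'
  proof -
    let ?J = "independent_sets ?Y \<times> independent_sets ?Z"
    let ?c = "\<lambda>(I, K). w I * w' K"
    have "chi_f X \<le> sum ?c ?J"
    proof (rule chi_f_le_cover(2)[OF X, where I = "\<lambda>(I, K). I \<inter> K"])
      show "finite ?J" using finite_independent_sets Y Z by blast
      fix v assume v: "v \<in> verts X"
      have "{j. j \<in> ?J \<and> v \<in> (case j of (I, K) \<Rightarrow> I \<inter> K)} =
          {I. I \<in> independent_sets ?Y \<and> v \<in> I} \<times> {K. K \<in> independent_sets ?Z \<and> v \<in> K}"
        by auto
      then have eq: "(\<Sum>j | j \<in> ?J \<and> v \<in> (case j of (I, K) \<Rightarrow> I \<inter> K). ?c j) =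
          (\<Sum>I | I \<in> independent_sets ?Y \<and> v \<in> I. w I) * (\<Sum>K | K \<in> independent_sets ?Z \<and> v \<in> K. w' K)"
        by (simp add: sum_product sum.cartesian_product)
      have 1: "1 \<le> (\<Sum>I | I \<in> independent_sets ?Y \<and> v \<in> I. w I)"
        and 2: "1 \<le> (\<Sum>K | K \<in> independent_sets ?Z \<and> v \<in> K. w' K)"
        using w w' v by (auto simp: fractional_colouring_def delete_edges_def)
      from mult_mono[OF 1 2] 1
      show "1 \<le> (\<Sum>j | j \<in> ?J \<and> v \<in> (case j of (I, K) \<Rightarrow> I \<inter> K). ?c j)"
        unfolding eq by simp
    next
      fix j assume j: "j \<in> ?J"
      then show "0 \<le> ?c j"
        using w w' by (auto simp: fractional_colouring_def intro!: mult_nonneg_nonneg)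
      \<comment> \<open>Each edge of \<open>X\<close> lies in \<open>F\<close> or survives in
        \<open>?Y\<close>, so two vertices of the intersection span no edge of either kind.\<close>
      from j show "(case j of (I, K) \<Rightarrow> I \<inter> K) \<in> independent_sets X"
        by (cases j) (simp add: independent_sets_def delete_edges_def, blast)
    qed
    then show ?thesis by (simp add: sum_product sum.cartesian_product)
  qed
  \<comment> \<open>The infimum is taken first over colourings of \<open>?Z\<close> with
    \<open>w\<close> fixed, then over \<open>w\<close>.\<close>
  have "chi_f X \<le> (\<Sum>I\<in>independent_sets ?Y. w I) * chi_f ?Z" if "fractional_colouring ?Y w" for w
    by (rule le_mult_chi_f[OF Z]) (use key fractional_colouring_total_nonneg that in blast)+
  then show ?thesis
    using le_mult_chi_f[OF Y chi_f_nonneg[OF Z], of "chi_f X"] by (simp add: mult.commute)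
qed

section \<open>Linear programming duality through approachability\<close>

text \<open>Blackwell's approachability argument: always adding a set that is heavy for the current
  positive deficits keeps the sum of squared deficits linear in the number of rounds.\<close>

lemma approachability:
  fixes c :: real and V :: "'a set"
  assumes V: "finite V" and c: "0 \<le> c"
    and sub: "\<And>I. I \<in> \<I> \<Longrightarrow> I \<subseteq> V"
    and heavy: "\<And>u :: 'a \<Rightarrow> real. (\<And>v. 0 \<le> u v) \<Longrightarrow> \<exists>I\<in>\<I>. c * sum u V \<le> sum u I"
  shows "\<exists>I. (\<forall>i<T. I i \<in> \<I>) \<and>
    (\<Sum>v\<in>V. (max 0 (c * real T - card {i. i < T \<and> v \<in> I i}))\<^sup>2) \<le> (1 + c)\<^sup>2 * card V * T"
proof (induction T)
  case 0
  show ?case by simp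
next
  case (Suc T)
  then obtain I where I: "\<And>i. i < T \<Longrightarrow> I i \<in> \<I>"
    and le: "(\<Sum>v\<in>V. (max 0 (c * real T - card {i. i < T \<and> v \<in> I i}))\<^sup>2) \<le> (1 + c)\<^sup>2 * card V * T"
    by auto
  define u where "u v = max 0 (c * real T - card {i. i < T \<and> v \<in> I i})" for v
  obtain K where K: "K \<in> \<I>" "c * sum u V \<le> sum u K" using heavy[of u] u_def by auto
  define I' where "I' = I(T := K)"
  have card_eq: "card {i. i < Suc T \<and> v \<in> I' i} =
      card {i. i < T \<and> v \<in> I i} + (if v \<in> K then 1 else 0)" for v
  proof -
    have "{i. i < Suc T \<and> v \<in> I' i} =
        (if v \<in> K then insert T {i. i < T \<and> v \<in> I i} else {i. i < T \<and> v \<in> I i})"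
      by (auto simp: I'_def less_Suc_eq)
    then show ?thesis by simp
  qed
  have step: "(max 0 (c * real (Suc T) - card {i. i < Suc T \<and> v \<in> I' i}))\<^sup>2
      \<le> (u v)\<^sup>2 + 2 * (c * u v - (if v \<in> K then u v else 0)) + (1 + c)\<^sup>2" for v
  proof -
    define x where "x = c * real T - card {i. i < T \<and> v \<in> I i}"
    define y :: real where "y = c - (if v \<in> K then 1 else 0)"
    have 1: "c * real (Suc T) - card {i. i < Suc T \<and> v \<in> I' i} = x + y"
      unfolding card_eq x_def y_def by (simp add: algebra_simps)
    \<comment> \<open>Replacing \<open>x\<close> by its positive part makes the cross term linear in
      \<open>u v\<close>, the quantity for which \<open>K\<close> was chosen to be heavy.\<close>
    have "max 0 (x + y) \<le> \<bar>max 0 x + y\<bar>" by linarith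
    then have "(max 0 (x + y))\<^sup>2 \<le> \<bar>max 0 x + y\<bar>\<^sup>2" by (intro power_mono) auto
    also have "\<dots> = (max 0 x)\<^sup>2 + 2 * (max 0 x * y) + y\<^sup>2" by (simp add: power2_sum)
    also have "y\<^sup>2 \<le> (1 + c)\<^sup>2" using c by (intro abs_le_square_iff[THEN iffD1]) (auto simp: y_def)
    finally show ?thesis unfolding 1 u_def x_def[symmetric] y_def by (simp add: algebra_simps split: if_splits)
  qed
  have "(\<Sum>v\<in>V. (max 0 (c * real (Suc T) - card {i. i < Suc T \<and> v \<in> I' i}))\<^sup>2)
      \<le> (\<Sum>v\<in>V. (u v)\<^sup>2 + 2 * (c * u v - (if v \<in> K then u v else 0)) + (1 + c)\<^sup>2)"
    by (intro sum_mono step)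
  also have "\<dots> = (\<Sum>v\<in>V. (u v)\<^sup>2) + 2 * (c * sum u V - (\<Sum>v\<in>V. if v \<in> K then u v else 0)) + card V * (1 + c)\<^sup>2"
    by (simp add: sum.distrib sum_distrib_left sum_subtractf)
  also have "(\<Sum>v\<in>V. if v \<in> K then u v else 0) = sum u K"
    using sum.inter_restrict[OF V, of u K] sub[OF K(1)] by (simp add: Int_absorb1)
  also have "(\<Sum>v\<in>V. (u v)\<^sup>2) + 2 * (c * sum u V - sum u K) + card V * (1 + c)\<^sup>2
      \<le> (1 + c)\<^sup>2 * card V * T + card V * (1 + c)\<^sup>2"
  \<comment> \<open>The choice of \<open>K\<close> makes the cross term nonpositive, so one round
    costs at most \<open>(1 + c)\<^sup>2\<close> per vertex.\<close>
  proof (rule add_right_mono)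
    have "2 * (c * sum u V - sum u K) \<le> 0" using K(2) by simp
    from add_mono[OF le[folded u_def] this]
    show "(\<Sum>v\<in>V. (u v)\<^sup>2) + 2 * (c * sum u V - sum u K) \<le> (1 + c)\<^sup>2 * card V * T" by simp
  qed
  also have "\<dots> = (1 + c)\<^sup>2 * card V * Suc T" by (simp add: ring_distribs mult.commute)
  finally have "(\<Sum>v\<in>V. (max 0 (c * real (Suc T) - card {i. i < Suc T \<and> v \<in> I' i}))\<^sup>2)
      \<le> (1 + c)\<^sup>2 * card V * Suc T" .
  moreover have "\<forall>i<Suc T. I' i \<in> \<I>" using I K(1) by (simp add: I'_def less_Suc_eq)
  ultimately show ?case by blast
qed

text \<open>LP duality with an arbitrarily small loss. If no such weights exist, every nonnegative
  weighting has an independent set with a \<open>1 / s\<close> share of its total; approachability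
  then gives a list of independent sets covering all vertices so evenly that equal weights beat
  \<open>chi_f X\<close>.\<close>

lemma fractional_clique:
  assumes X: "fin_simple_graph X" and s: "0 < s" "s < chi_f X"
  shows "\<exists>w. (\<forall>v. 0 \<le> w v) \<and> sum w (verts X) = s \<and> (\<forall>I\<in>independent_sets X. sum w I \<le> 1)"
proof (rule ccontr)
  assume no: "\<not> ?thesis"
  have V: "finite (verts X)" using X by (simp add: fin_simple_graph_def)
  have heavy: "\<exists>I\<in>independent_sets X. (1 / s) * sum u (verts X) \<le> sum u I"
    if u: "\<And>v. 0 \<le> u v" for u :: "'a \<Rightarrow> real"
  proof (cases "sum u (verts X) = 0")
    case True
    then show ?thesis by (intro bexI[of _ "{}"]) (auto simp: independent_sets_def)
  next
    case False
    \<comment> \<open>Scaling by \<open>a\<close> brings \<open>u\<close> to total \<open>s\<close>,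
      so by assumption some independent set gets more than 1.\<close>
    define a where "a = s / sum u (verts X)"
    have a: "0 < a" using False sum_nonneg[of "verts X" u] u s by (auto simp: a_def less_le)
    have "(\<Sum>v\<in>verts X. a * u v) = s"
      using False by (simp add: a_def sum_distrib_left[symmetric] del: times_divide_eq_left) (simp add: times_divide_eq_left)
    then obtain I where I: "I \<in> independent_sets X" "\<not> (\<Sum>v\<in>I. a * u v) \<le> 1"
      using no u a by (metis (no_types, lifting) less_imp_le mult_nonneg_nonneg)
    then have "1 \<le> a * sum u I" by (simp flip: sum_distrib_left)
    then have "(1 / s) * sum u (verts X) \<le> sum u I"
      using a s unfolding a_def by (simp add: zero_less_divide_iff pos_le_divide_eq pos_divide_le_eq mult.commute)
    then show ?thesis using I by blast
  qed
  define c where "c = 1 / s"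
  \<comment> \<open>Half the gap between \<open>1 / s\<close> and \<open>1 / chi_f X\<close>: a
    covering frequency of \<open>c - e\<close> still contradicts the value of
    \<open>chi_f X\<close>.\<close>
  define e where "e = (c - 1 / chi_f X) / 2"
  have pos: "0 < c" "0 < chi_f X" "1 / chi_f X < c" "0 < e"
    using s by (auto simp: c_def e_def field_simps)
  \<comment> \<open>The squared deficits grow linearly in the number of rounds, so for this
    \<open>T\<close> they are at most \<open>(e * T)\<^sup>2\<close>.\<close>
  define T where "T = nat \<lceil>(1 + c)\<^sup>2 * card (verts X) / e\<^sup>2\<rceil> + 1"
  have T: "0 < T" "(1 + c)\<^sup>2 * card (verts X) \<le> e\<^sup>2 * T"
  proof -
    have "(1 + c)\<^sup>2 * card (verts X) / e\<^sup>2 \<le> T" unfolding T_def by linarith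
    then show "(1 + c)\<^sup>2 * card (verts X) \<le> e\<^sup>2 * T"
      using pos(4) by (simp add: pos_divide_le_eq mult.commute)
  qed (simp add: T_def)
  obtain I where I: "\<forall>i<T. I i \<in> independent_sets X"
    and le: "(\<Sum>v\<in>verts X. (max 0 (c * real T - card {i. i < T \<and> v \<in> I i}))\<^sup>2) \<le> (1 + c)\<^sup>2 * card (verts X) * T"
    using approachability[OF V less_imp_le[OF pos(1)], of "independent_sets X" T]
      heavy[folded c_def] independent_setsD by blast
  have cover: "(c - e) * T \<le> card {i. i < T \<and> v \<in> I i}" if v: "v \<in> verts X" for v
  proof -
    let ?x = "max 0 (c * real T - card {i. i < T \<and> v \<in> I i})"
    have "?x\<^sup>2 \<le> (\<Sum>v\<in>verts X. (max 0 (c * real T - card {i. i < T \<and> v \<in> I i}))\<^sup>2)"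
      by (rule member_le_sum[OF v, of "\<lambda>v. (max 0 (c * real T - card {i. i < T \<and> v \<in> I i}))\<^sup>2"]) (use V in auto)
    also note le
    also have "(1 + c)\<^sup>2 * card (verts X) * T \<le> e\<^sup>2 * T * T"
      using T by (intro mult_right_mono) auto
    also have "\<dots> = (e * T)\<^sup>2" by (simp add: power2_eq_square)
    finally have "?x \<le> e * T" by (rule power2_le_imp_le) (use pos in auto)
    then show ?thesis by (simp add: algebra_simps)
  qed
  have ce: "1 / chi_f X < c - e" using pos unfolding e_def by (simp add: field_simps)
  then have ce0: "0 < c - e" using pos by (meson less_trans zero_less_divide_1_iff)
  have "chi_f X \<le> (\<Sum>i<T. 1 / ((c - e) * T))"
  proof (rule chi_f_le_cover(2)[OF X, where I = I])
    fix v assume "v \<in> verts X"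
    from cover[OF this] show "1 \<le> (\<Sum>i | i \<in> {..<T} \<and> v \<in> I i. 1 / ((c - e) * T))"
      using ce0 T by (simp add: field_simps)
  qed (use I ce0 in auto)
  also have "\<dots> = 1 / (c - e)" using T ce0 by simp
  also have "\<dots> < chi_f X" using ce ce0 pos by (simp add: field_simps)
  finally show False by simp
qed

section \<open>Dense initial segments\<close>

text \<open>Greedy colouring in increasing order: a new maximum leaves the earlier neighbours of the
  other elements unchanged and sees fewer than \<open>d\<close> colours itself.\<close>

lemma degenerate_colouring:
  fixes S :: "nat set"
  assumes "finite S" "\<And>i. i \<in> S \<Longrightarrow> card {j \<in> S. j < i \<and> adj j i} < d"
  shows "\<exists>c :: nat \<Rightarrow> nat. (\<forall>i\<in>S. c i < d) \<and> (\<forall>i\<in>S. \<forall>j\<in>S. j < i \<and> adj j i \<longrightarrow> c j \<noteq> c i)"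
  using assms
proof (induction S rule: finite_linorder_max_induct)
  case empty
  then show ?case by simp
next
  case (insert b S)
  have "card {j \<in> S. j < i \<and> adj j i} < d" if "i \<in> S" for i
  proof -
    have "{j \<in> insert b S. j < i \<and> adj j i} = {j \<in> S. j < i \<and> adj j i}"
      using insert.hyps(2) that by fastforce
    then show ?thesis using insert.prems[of i] that by simp
  qed
  then obtain c :: "nat \<Rightarrow> nat" where c: "\<forall>i\<in>S. c i < d" "\<forall>i\<in>S. \<forall>j\<in>S. j < i \<and> adj j i \<longrightarrow> c j \<noteq> c i"
    using insert.IH by blast
  let ?N = "{j \<in> insert b S. j < b \<and> adj j b}"
  have N: "finite ?N" "card ?N < d" using insert.prems[of b] insert.hyps(1) by auto
  have "card (c ` ?N) < card {..<d}" using card_image_le[OF N(1), of c] N(2) by simp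
  then obtain k where k: "k < d" "k \<notin> c ` ?N"
    using N(1) by (meson card_mono finite_imageI lessThan_iff not_less subsetI)
  have lt: "i < b" if "i \<in> S" for i using insert.hyps(2) that by blast
  have "(c(b := k)) i < d" if "i \<in> insert b S" for i
    using that c(1) k(1) by auto
  moreover have "(c(b := k)) j \<noteq> (c(b := k)) i"
    if ij: "i \<in> insert b S" "j \<in> insert b S" "j < i" "adj j i" for i j
  proof (cases "i = b")
    case True
    then show ?thesis using ij k(2) by auto
  next
    case False
    then have "i \<in> S" using ij(1) by simp
    moreover from this have "j \<noteq> b" using lt ij(3) by fastforce
    ultimately show ?thesis using ij c(2) False by auto
  qed
  ultimately show ?case by blast
qed

text \<open>Each of the \<open>d\<close> greedy colour classes is independent and so weighs at most
  1.\<close>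

lemma degenerate_weight_le:
  fixes S :: "nat set" and w :: "nat \<Rightarrow> real"
  assumes S: "finite S" "\<And>i. i \<in> S \<Longrightarrow> card {j \<in> S. j < i \<and> adj j i} < d"
    and indep: "\<And>I. I \<subseteq> S \<Longrightarrow> (\<And>i j. i \<in> I \<Longrightarrow> j \<in> I \<Longrightarrow> j < i \<Longrightarrow> \<not> adj j i) \<Longrightarrow> sum w I \<le> 1"
  shows "sum w S \<le> d"
proof -
  obtain c :: "nat \<Rightarrow> nat" where c: "\<forall>i\<in>S. c i < d"
      "\<forall>i\<in>S. \<forall>j\<in>S. j < i \<and> adj j i \<longrightarrow> c j \<noteq> c i"
    using degenerate_colouring[where adj=adj, OF S] by blast
  have "sum w S = (\<Sum>k<d. sum w {i \<in> S. c i = k})"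
    by (rule sum.group[symmetric]) (use S(1) c in auto)
  also have "\<dots> \<le> (\<Sum>k<d. 1)"
    by (intro sum_mono indep) (use c(2) in auto)
  finally show ?thesis by simp
qed

text \<open>Abel summation as an induction: since the partial sums of \<open>g\<close> are
  nonpositive, replacing \<open>w k\<close> by the smaller \<open>w (Suc k)\<close> only weakens the
  bound.\<close>

lemma weighted_sum_nonpos:
  fixes w g :: "nat \<Rightarrow> real"
  assumes anti: "\<And>i j. i \<le> j \<Longrightarrow> j < n \<Longrightarrow> w j \<le> w i" and nonneg: "\<And>i. 0 \<le> w i"
    and g: "\<And>m. m < n \<Longrightarrow> sum g {..m} \<le> 0"
  shows "(\<Sum>i<n. w i * g i) \<le> 0"
proof (cases n)
  case (Suc m)
  have "(\<Sum>i\<le>k. w i * g i) \<le> w k * sum g {..k}" if "k < n" for k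
    using that
  proof (induction k)
    case (Suc k)
    have "w k * sum g {..k} \<le> w (Suc k) * sum g {..k}"
      using anti[of k "Suc k"] g[of k] Suc.prems by (intro mult_right_mono_neg) auto
    then show ?case using Suc by (simp add: algebra_simps)
  qed simp
  from this[of m] g[of m] nonneg[of m] show ?thesis
    using mult_nonneg_nonpos[of "w m" "sum g {..m}"] Suc by (simp add: lessThan_Suc_atMost)
qed simp

text \<open>The witness \<open>T\<close> is an initial segment of \<open>S\<close>, found by Abel summation applied to
  \<open>[i \<in> H] - [i \<in> S] / 3 - A / (6 t)\<close>, where \<open>H\<close> is the set of elements of \<open>S\<close> with at least
  \<open>d\<close> earlier neighbours in \<open>S\<close>; its complement in \<open>S\<close> is \<open>d\<close>-colourable.\<close>

lemma dense_prefix: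
  fixes w :: "nat \<Rightarrow> real" and A t :: real
  assumes anti: "\<And>i j. i \<le> j \<Longrightarrow> j < n \<Longrightarrow> w j \<le> w i" and nonneg: "\<And>i. 0 \<le> w i"
    and total: "(\<Sum>i<n. w i) \<le> t" and t: "0 < t"
    and indep: "\<And>I. I \<subseteq> {..<n} \<Longrightarrow> (\<And>i j. i \<in> I \<Longrightarrow> j \<in> I \<Longrightarrow> j < i \<Longrightarrow> \<not> adj j i) \<Longrightarrow> sum w I \<le> 1"
    and S: "S \<subseteq> {..<n}" "A \<le> sum w S" and d: "real d < A / 2"
  shows "\<exists>T\<subseteq>S. d < card T \<and> (\<forall>i\<in>T. real (Suc i) \<le> 4 * t * card T / A) \<and>
    real d * card T \<le> 3 * card {(j, i). j \<in> T \<and> i \<in> T \<and> j < i \<and> adj j i}"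
proof -
  have finS: "finite S" using S(1) finite_subset by blast
  have A: "0 < A" using d by simp
  define N where "N i = {j \<in> S. j < i \<and> adj j i}" for i
  define H where "H = {i \<in> S. d \<le> card (N i)}"
  have HS: "H \<subseteq> S" by (auto simp: H_def)
  have "sum w (S - H) \<le> d"
  proof (rule degenerate_weight_le[where adj=adj])
    fix i assume i: "i \<in> S - H"
    have "card {j \<in> S - H. j < i \<and> adj j i} \<le> card (N i)"
      unfolding N_def by (rule card_mono) (use finS in auto)
    then show "card {j \<in> S - H. j < i \<and> adj j i} < d" using i by (auto simp: H_def)
  qed (use finS S(1) in \<open>auto intro!: indep\<close>)
  then have wH: "sum w S - d \<le> sum w H"
    using sum.subset_diff[OF HS finS, of w] by linarith
  define g where "g i = (if i \<in> H then 1 else 0) - (if i \<in> S then 1 else 0) / 3 - A / (6 * t)" for i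
  have sum_ind: "(\<Sum>i<n. w i * (if i \<in> B then 1 else 0)) = sum w B" if "B \<subseteq> {..<n}" for B
  proof -
    have "(\<Sum>i<n. w i * (if i \<in> B then 1 else 0)) = (\<Sum>i<n. if i \<in> B then w i else 0)"
      by (intro sum.cong) auto
    then show ?thesis using that by (simp add: sum.inter_restrict[symmetric] Int_absorb1)
  qed
  have "(\<Sum>i<n. w i * g i) = (\<Sum>i<n. w i * (if i \<in> H then 1 else 0))
      - (\<Sum>i<n. w i * (if i \<in> S then 1 else 0)) / 3 - A / (6 * t) * (\<Sum>i<n. w i)"
    unfolding g_def by (simp add: sum_subtractf sum.distrib sum_divide_distrib sum_distrib_left algebra_simps)
  also have "\<dots> = sum w H - sum w S / 3 - A / (6 * t) * (\<Sum>i<n. w i)"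
    using HS S(1) by (subst (1 2) sum_ind) auto
  finally have "(\<Sum>i<n. w i * g i) = sum w H - sum w S / 3 - A / (6 * t) * (\<Sum>i<n. w i)" .
  moreover have "A / (6 * t) * (\<Sum>i<n. w i) \<le> A / (6 * t) * t"
    using A t total by (intro mult_left_mono) auto
  moreover have "A / (6 * t) * t = A / 6" using t by simp
  \<comment> \<open>The sum is at least \<open>(2 / 3) * A - d - A / 6 = A / 2 - d\<close>, which is
    positive by the choice of \<open>d\<close>.\<close>
  ultimately have "0 < (\<Sum>i<n. w i * g i)" using wH S(2) d by linarith
  have "\<not> (\<forall>m<n. sum g {..m} \<le> 0)"
  proof
    assume "\<forall>m<n. sum g {..m} \<le> 0"
    with anti nonneg have "(\<Sum>i<n. w i * g i) \<le> 0" by (intro weighted_sum_nonpos) auto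
    with \<open>0 < (\<Sum>i<n. w i * g i)\<close> show False by simp
  qed
  then obtain m' where m': "0 < sum g {..m'}" by (auto simp: not_le)
  \<comment> \<open>At the first positive partial sum the last term \<open>g m\<close> is positive;
    as \<open>g\<close> is negative outside \<open>H\<close>, this puts \<open>m\<close> in
    \<open>H\<close>.\<close>
  define m where "m = (LEAST m. 0 < sum g {..m})"
  have m: "0 < sum g {..m}" unfolding m_def using m' by (rule LeastI)
  have least: "\<not> 0 < sum g {..k}" if "k < m" for k using that not_less_Least unfolding m_def by blast
  have "0 < g m"
  proof (cases m)
    case (Suc k)
    then show ?thesis using m least[of k] by (simp add: not_less)
  qed (use m in simp)
  moreover have "0 < A / (6 * t)" using A t by simp
  ultimately have mH: "m \<in> H" unfolding g_def by (simp split: if_splits)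
  define T where "T = S \<inter> {..m}"
  have finT: "finite T" by (simp add: T_def)
  have TS: "T \<subseteq> S" by (auto simp: T_def)
  have "sum g {..m} = card (H \<inter> {..m}) - card T / 3 - A / (6 * t) * Suc m"
  proof -
    have "(\<Sum>i\<le>m. if i \<in> B then 1 else 0 :: real) = card (B \<inter> {..m})" for B
      by (simp add: sum.inter_restrict[symmetric] Int_commute)
    then show ?thesis
      unfolding g_def T_def
      by (simp add: sum_subtractf sum.distrib sum_divide_distrib[symmetric] algebra_simps)
  qed
  with m have ineq: "card T / 3 + A / (6 * t) * Suc m < card (H \<inter> {..m})" by linarith
  \<comment> \<open>\<open>ineq\<close> is used twice: with this upper bound it limits the length of
    the segment, and by itself it shows that more than a third of \<open>T\<close> lies in
    \<open>H\<close>.\<close>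
  have "card (H \<inter> {..m}) \<le> card T"
    unfolding T_def by (rule card_mono) (use HS in auto)
  with ineq have "A / (6 * t) * Suc m \<le> 2 * card T / 3" by linarith
  then have seg: "real (Suc m) \<le> 4 * t * card T / A"
    using A t by (simp add: field_simps)
  \<comment> \<open>As \<open>m\<close> is in \<open>H\<close>, it has at least \<open>d\<close>
    earlier neighbours, and with \<open>m\<close> itself \<open>T\<close> has more than
    \<open>d\<close> elements.\<close>
  have "insert m (N m) \<subseteq> T" using mH HS by (auto simp: T_def N_def)
  then have "card (insert m (N m)) \<le> card T" using card_mono finT by blast
  moreover have "card (insert m (N m)) = Suc (card (N m))"
    using finS by (subst card_insert_disjoint) (auto simp: N_def)
  ultimately have dT: "d < card T" using mH by (simp add: H_def)
  let ?P = "{(j, i). j \<in> T \<and> i \<in> T \<and> j < i \<and> adj j i}"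
  have "finite ?P" by (rule finite_subset[of _ "T \<times> T"]) (use finT in auto)
  \<comment> \<open>Earlier neighbours of an element of the segment lie in the segment too, so each
    element of \<open>H\<close> up to \<open>m\<close> contributes at least \<open>d\<close> pairs
    inside \<open>T\<close>.\<close>
  moreover have "(\<lambda>(i, j). (j, i)) ` (SIGMA i:H \<inter> {..m}. N i) \<subseteq> ?P"
    using HS by (auto simp: T_def N_def)
  ultimately have "card ((\<lambda>(i, j). (j, i)) ` (SIGMA i:H \<inter> {..m}. N i)) \<le> card ?P"
    by (rule card_mono)
  also have "card ((\<lambda>(i, j). (j, i)) ` (SIGMA i:H \<inter> {..m}. N i)) = card (SIGMA i:H \<inter> {..m}. N i)"
    by (rule card_image) (auto simp: inj_on_def)
  also have "\<dots> = (\<Sum>i\<in>H \<inter> {..m}. card (N i))"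
    using finS by (intro card_SigmaI) (auto simp: N_def)
  finally have "(\<Sum>i\<in>H \<inter> {..m}. card (N i)) \<le> card ?P" .
  moreover have "card (H \<inter> {..m}) * d \<le> (\<Sum>i\<in>H \<inter> {..m}. card (N i))"
    using sum_bounded_below[of "H \<inter> {..m}" d "\<lambda>i. card (N i)"] by (simp add: H_def)
  ultimately have "card (H \<inter> {..m}) * d \<le> card ?P" by (rule order_trans[rotated])
  then have "real (card (H \<inter> {..m}) * d) \<le> real (card ?P)" by (rule of_nat_mono)
  then have "real (card (H \<inter> {..m})) * d \<le> card ?P" by simp
  moreover have "real (card T) * d \<le> 3 * real (card (H \<inter> {..m})) * d"
  proof (rule mult_right_mono)
    have "0 \<le> A / (6 * t) * Suc m" using A t by simp
    with ineq show "real (card T) \<le> 3 * real (card (H \<inter> {..m}))" by linarith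
  qed simp
  ultimately have "real d * card T \<le> 3 * card ?P" by (simp add: mult.commute)
  moreover have "\<forall>i\<in>T. real (Suc i) \<le> 4 * t * card T / A"
    using seg unfolding T_def by force
  ultimately show ?thesis using TS dT by blast
qed

text \<open>The left side divided by \<open>fact k\<close> is a single term of the exponential
  series at \<open>k\<close>.\<close>

lemma power_self_le_exp_fact: "real k ^ k \<le> exp k * fact k"
proof -
  have "(\<Sum>i\<in>{k}. real k ^ i /\<^sub>R fact i) \<le> (\<Sum>i. real k ^ i /\<^sub>R fact i)"
    by (rule sum_le_suminf) (use summable_exp_generic[of "real k"] in auto)
  also have "\<dots> = exp k" by (simp add: exp_def)
  finally show ?thesis by (simp add: field_simps)
qed

lemma binomial_le_exp_power:
  assumes "0 < k" "real m \<le> x * k"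
  shows "real (m choose k) \<le> (exp 1 * x) ^ k"
proof -
  have "real (m choose k) * fact k \<le> real m ^ k"
    using binomial_fact_pow[of m k] by (metis of_nat_fact of_nat_le_iff of_nat_mult of_nat_power)
  also have "\<dots> \<le> (x * k) ^ k" using assms by (intro power_mono) auto
  also have "\<dots> = x ^ k * real k ^ k" by (simp add: power_mult_distrib)
  also have "\<dots> \<le> x ^ k * (exp k * fact k)"
  proof (rule mult_left_mono[OF power_self_le_exp_fact])
    have "0 \<le> x * k" using assms by linarith
    then show "0 \<le> x ^ k" using assms(1) by (simp add: zero_le_mult_iff)
  qed
  also have "exp (real k) = exp 1 ^ k" by (simp flip: exp_of_nat_mult)
  finally show ?thesis by (simp add: power_mult_distrib mult.commute)
qed

section \<open>Independent sets of the random subgraph\<close>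

text \<open>The event is a product set, unconstrained at edges outside \<open>D\<close>, so the
  probability factorises.\<close>

lemma prob_all_deleted:
  assumes "finite E" "D \<subseteq> E" "0 \<le> p" "p \<le> 1"
  shows "measure_pmf.prob (Pi_pmf E False (\<lambda>_. bernoulli_pmf p)) {keep. \<forall>e\<in>D. \<not> keep e} = (1 - p) ^ card D"
proof -
  have D: "finite D" using assms finite_subset by blast
  have "{keep. \<forall>e\<in>D. \<not> keep e} = Pi E (\<lambda>e. if e \<in> D then {False} else UNIV)"
    using assms(2) by (auto simp: Pi_iff split: if_splits)
  then have "measure_pmf.prob (Pi_pmf E False (\<lambda>_. bernoulli_pmf p)) {keep. \<forall>e\<in>D. \<not> keep e} =
      (\<Prod>e\<in>E. measure_pmf.prob (bernoulli_pmf p) (if e \<in> D then {False} else UNIV))"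
    using measure_Pi_pmf_Pi[OF assms(1)] by simp
  also have "\<dots> = (\<Prod>e\<in>E. if e \<in> D then 1 - p else 1)"
    using assms by (intro prod.cong) (auto simp: measure_pmf_single)
  also have "\<dots> = (\<Prod>e\<in>D. 1 - p)"
    using assms by (simp add: prod.inter_restrict[symmetric] Int_absorb1)
  finally show ?thesis by simp
qed

lemma A_factor_gt:
  assumes "1 \<le> t" "0 < p" "p < 1"
  shows "4 < A_factor t p"
proof -
  have "1 < exp (1::real)" by simp
  then have "1 * 1 < exp 1 * t" using assms(1) by (intro mult_less_le_imp_less) auto
  then have "1 < 2 * exp 1 * t" by simp
  moreover have "1 < 1 / (1 - p)" using assms by simp
  ultimately have "0 < log (1 / (1 - p)) (2 * exp 1 * t)"
    by (subst zero_less_log_cancel_iff) (use assms(1) in auto)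
  then show ?thesis by (simp add: A_factor_def)
qed

text \<open>The hypotheses give \<open>e\<close> at least \<open>(4 * L + 1) * k / 3\<close>, and
  for \<open>k\<close> at least 3 this is at least \<open>L * Suc k\<close>. The exponent
  \<open>Suc k\<close> instead of \<open>k\<close> leaves a spare factor \<open>1 / x\<close> for
  the final probability.\<close>

lemma power_deleted_le:
  fixes L q x :: real
  assumes q: "0 < q" "q < 1" and x: "1 < x" and L: "L = log (1 / q) x"
    and d: "4 * L + 1 \<le> d" and k: "3 \<le> k" and e: "real d * k \<le> 3 * e"
  shows "q ^ e \<le> (1 / x) ^ Suc k"
proof -
  have L0: "0 < L" using q x unfolding L by (intro zero_less_log_cancel_iff[THEN iffD2]) auto
  have "L * 3 \<le> L * k" using L0 k by (intro mult_left_mono) auto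
  moreover have "(4 * L + 1) * k \<le> real d * k" using d by (intro mult_right_mono) auto
  ultimately have "L * Suc k \<le> e" using e by (simp add: algebra_simps)
  then have "(1 / q) powr (L * Suc k) \<le> (1 / q) powr e" using q by (intro powr_mono) auto
  moreover have "(1 / q) powr (L * Suc k) = x ^ Suc k"
  proof -
    have "(1 / q) powr L = x" unfolding L using q x by (intro powr_log_cancel) auto
    then show ?thesis using x powr_powr[of "1 / q" L "Suc k"] powr_realpow[of x "Suc k"] by simp
  qed
  moreover have "(1 / q) powr e = 1 / q ^ e"
    using q powr_realpow[of "1 / q" e] by (simp add: power_one_over)
  ultimately have "x ^ Suc k \<le> 1 / q ^ e" by simp
  moreover have "0 < x ^ Suc k" "0 < q ^ e" using q x by auto
  ultimately show ?thesis by (simp add: power_one_over field_simps)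
qed

lemma sum_half_powers_le: "(\<Sum>k\<in>{1..n}. (1 / 2 :: real) ^ k) \<le> 1"
proof -
  have "(\<Sum>k\<in>{1..n}. (1 / 2 :: real) ^ k) = 1 - (1 / 2) ^ n"
    by (induction n) (auto simp: field_simps)
  then show ?thesis by simp
qed

lemma enumerate_decreasing:
  fixes w :: "'a \<Rightarrow> real"
  assumes "finite V"
  shows "\<exists>f. bij_betw f {..<card V} V \<and> (\<forall>i j. i \<le> j \<longrightarrow> j < card V \<longrightarrow> w (f j) \<le> w (f i))"
proof -
  obtain us where us: "set us = V" "distinct us" using finite_distinct_list[OF assms] by blast
  define vs where "vs = sort_key (\<lambda>v. - w v) us"
  have vs: "set vs = V" "distinct vs" using us by (auto simp: vs_def)
  then have len: "length vs = card V" using distinct_card by fastforce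
  have "sorted (map (\<lambda>v. - w v) vs)" by (simp add: vs_def)
  then have "w (vs ! j) \<le> w (vs ! i)" if "i \<le> j" "j < card V" for i j
    using sorted_nth_mono[of "map (\<lambda>v. - w v) vs" i j] that len by simp
  moreover have "bij_betw ((!) vs) {..<card V} V"
    by (rule bij_betw_nth) (use vs len in auto)
  ultimately show ?thesis by blast
qed

text \<open>Union bound over the sets \<open>T\<close>: those with \<open>k\<close> elements lie in an initial segment of length at
  most \<open>4 t k / A\<close>, hence there are at most \<open>(e t)\<^sup>k\<close> of them, however large \<open>G\<close> is.\<close>

lemma prob_heavy_independent_le:
  fixes w :: "'a \<Rightarrow> real"
  assumes G: "fin_simple_graph G" and p: "0 < p" "p < 1" and t: "1 \<le> t"
    and nonneg: "\<And>v. 0 \<le> w v" and total: "sum w (verts G) \<le> t"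
    and indep: "\<And>I. I \<in> independent_sets G \<Longrightarrow> sum w I \<le> 1"
  shows "measure_pmf.prob (random_subgraph G p)
      {X. \<exists>S\<in>independent_sets X. A_factor t p \<le> sum w S} \<le> 1 / (2 * t)"
proof -
  define n where "n = card (verts G)"
  have finV: "finite (verts G)" using G by (simp add: fin_simple_graph_def)
  have finE: "finite (edges G)"
    using G finV by (auto simp: fin_simple_graph_def intro: finite_subset[of _ "Pow (verts G)"])
  obtain f where f: "bij_betw f {..<n} (verts G)"
      and anti: "\<And>i j. i \<le> j \<Longrightarrow> j < n \<Longrightarrow> w (f j) \<le> w (f i)"
    using enumerate_decreasing[OF finV, of w] unfolding n_def by blast
  have inj: "inj_on f {..<n}" and img: "f ` {..<n} = verts G"
    using f by (auto simp: bij_betw_def)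
  define A where "A = A_factor t p"
  define x where "x = 2 * exp 1 * t"
  define L where "L = log (1 / (1 - p)) x"
  have A: "A = 8 * L + 4" "4 < A"
    using A_factor_gt[OF t p] by (simp_all add: A_def A_factor_def L_def x_def)
  have "1 * 1 < exp 1 * t" using t by (intro mult_less_le_imp_less) auto
  then have x: "1 < x" by (simp add: x_def)
  \<comment> \<open>Rounding up stays below \<open>4 * L + 2 = A / 2\<close>, as
    \<open>dense_prefix\<close> requires, and \<open>L > 0\<close> gives \<open>2 \<le> d\<close>,
    so candidates have at least three elements.\<close>
  define d where "d = nat \<lceil>4 * L + 1\<rceil>"
  have d: "4 * L + 1 \<le> d" "d < A / 2" "2 \<le> d"
    using A unfolding d_def by linarith+
  define adj where "adj j i \<longleftrightarrow> {f j, f i} \<in> edges G" for j i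
  define E where "E T = {e \<in> edges G. e \<subseteq> f ` T}" for T
  \<comment> \<open>The candidates depend on \<open>G\<close> and the weights only, not on the
    random choice \<open>keep\<close>.\<close>
  define \<T> where "\<T> = {T. T \<subseteq> {..<n} \<and> d < card T \<and> (\<forall>i\<in>T. real (Suc i) \<le> 4 * t * card T / A) \<and>
    real d * card T \<le> 3 * card (E T)}"
  have fin\<T>: "finite \<T>" by (rule finite_subset[of _ "Pow {..<n}"]) (auto simp: \<T>_def)
  let ?M = "Pi_pmf (edges G) False (\<lambda>_. bernoulli_pmf p)"
  let ?X = "\<lambda>keep. Graph (verts G) {e \<in> edges G. keep e}"
  have sub: "{keep. \<exists>S\<in>independent_sets (?X keep). A \<le> sum w S}
      \<subseteq> (\<Union>T\<in>\<T>. {keep. \<forall>e\<in>E T. \<not> keep e})"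
  proof
    fix keep assume "keep \<in> {keep. \<exists>S\<in>independent_sets (?X keep). A \<le> sum w S}"
    then obtain S where S: "S \<in> independent_sets (?X keep)" "A \<le> sum w S" by blast
    define S' where "S' = {i \<in> {..<n}. f i \<in> S}"
    have SV: "S \<subseteq> verts G" using S(1) by (auto simp: independent_sets_def)
    then have fS: "f ` S' = S" using img unfolding S'_def by fastforce
    have S'n: "S' \<subseteq> {..<n}" by (auto simp: S'_def)
    have "(\<Sum>i\<in>S'. w (f i)) = sum w S"
      using sum.reindex[OF inj_on_subset[OF inj S'n], of w] fS by simp
    moreover have "(\<Sum>i<n. w (f i)) = sum w (verts G)"
      using sum.reindex_bij_betw[OF f, of w] by simp
    moreover have "(\<Sum>i\<in>I. w (f i)) \<le> 1"
      if I: "I \<subseteq> {..<n}" "\<And>i j. i \<in> I \<Longrightarrow> j \<in> I \<Longrightarrow> j < i \<Longrightarrow> \<not> adj j i" for I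
    proof -
      have "{f i, f j} \<notin> edges G" if "i \<in> I" "j \<in> I" for i j
      proof (cases i j rule: linorder_cases)
        case equal
        then show ?thesis using G by (fastforce simp: fin_simple_graph_def)
      qed (use I(2)[of i j] I(2)[of j i] that in \<open>auto simp: adj_def insert_commute\<close>)
      then have "f ` I \<in> independent_sets G"
        using I(1) img by (fastforce simp: independent_sets_def)
      then have "sum w (f ` I) \<le> 1" by (rule indep)
      then show ?thesis using sum.reindex[OF inj_on_subset[OF inj I(1)], of w] by simp
    qed
    ultimately obtain T where T: "T \<subseteq> S'" "d < card T" "\<forall>i\<in>T. real (Suc i) \<le> 4 * t * card T / A"
        "real d * card T \<le> 3 * card {(j, i). j \<in> T \<and> i \<in> T \<and> j < i \<and> adj j i}"
      using dense_prefix[of n "\<lambda>i. w (f i)" t adj S' A d] anti nonneg total t S'n S(2) d by auto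
    have Tn: "T \<subseteq> {..<n}" using T(1) S'n by blast
    let ?P = "{(j, i). j \<in> T \<and> i \<in> T \<and> j < i \<and> adj j i}"
    \<comment> \<open>Turns the count of index pairs \<open>j < i\<close> into a count of edges; the
      order of the indices prevents an edge from being counted twice.\<close>
    have "inj_on (\<lambda>(j, i). {f j, f i}) ?P"
    proof (rule inj_onI, clarify)
      fix j i j' i'
      assume *: "j \<in> T" "i \<in> T" "j < i" "j' \<in> T" "i' \<in> T" "j' < i'" "{f j, f i} = {f j', f i'}"
      then have "f ` {j, i} = f ` {j', i'}" by simp
      then have "{j, i} = {j', i'}"
        using inj_on_image_eq_iff[OF inj, of "{j, i}" "{j', i'}"] * Tn by blast
      then show "j = j' \<and> i = i'" using *(3,6) by (auto simp: doubleton_eq_iff)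
    qed
    moreover have "(\<lambda>(j, i). {f j, f i}) ` ?P \<subseteq> E T" by (auto simp: E_def adj_def)
    moreover have "finite (E T)" using finE by (simp add: E_def)
    ultimately have "card ?P \<le> card (E T)" by (rule card_inj_on_le)
    then have "T \<in> \<T>" using T Tn unfolding \<T>_def by auto
    moreover have "\<not> keep e" if "e \<in> E T" for e
    proof -
      have e: "e \<in> edges G" "e \<subseteq> S" using that image_mono[OF T(1), of f] fS by (auto simp: E_def)
      then obtain u v where "e = {u, v}"
        using G by (auto simp: fin_simple_graph_def card_2_iff)
      then show ?thesis using S(1) e by (auto simp: independent_sets_def)
    qed
    ultimately show "keep \<in> (\<Union>T\<in>\<T>. {keep. \<forall>e\<in>E T. \<not> keep e})" by blast
  qed
  \<comment> \<open>At most \<open>(x / 2) ^ k\<close> candidates of size \<open>k\<close>, each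
    with all its edges deleted with probability at most \<open>(1 / x) ^ Suc k\<close>.\<close>
  have level: "(\<Sum>T | T \<in> \<T> \<and> card T = k. (1 - p) ^ card (E T)) \<le> (1 / 2) ^ k / x" for k
  proof (cases "3 \<le> k")
    case False
    then have none: "{T. T \<in> \<T> \<and> card T = k} = {}" using d(3) by (auto simp: \<T>_def)
    show ?thesis unfolding none using x by simp
  next
    case True
    define m where "m = nat \<lfloor>4 * t * k / A\<rfloor>"
    have m: "real m \<le> (4 * t / A) * k" using A t unfolding m_def by simp
    have "{T. T \<in> \<T> \<and> card T = k} \<subseteq> {T. T \<subseteq> {..<m} \<and> card T = k}"
    proof (rule subsetI)
      fix T assume T: "T \<in> {T. T \<in> \<T> \<and> card T = k}"
      have "i < m" if "i \<in> T" for i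
      proof -
        have "real (Suc i) \<le> 4 * t * k / A" using T that by (auto simp: \<T>_def)
        then show ?thesis unfolding m_def by linarith
      qed
      then show "T \<in> {T. T \<subseteq> {..<m} \<and> card T = k}" using T by auto
    qed
    then have "card {T. T \<in> \<T> \<and> card T = k} \<le> card {T. T \<subseteq> {..<m} \<and> card T = k}"
      by (rule card_mono[rotated]) (auto intro: finite_subset[of _ "Pow {..<m}"])
    then have "card {T. T \<in> \<T> \<and> card T = k} \<le> m choose k" by (simp add: n_subsets)
    then have "real (card {T. T \<in> \<T> \<and> card T = k}) \<le> m choose k" by simp
    also have "\<dots> \<le> (exp 1 * (4 * t / A)) ^ k" using True m by (intro binomial_le_exp_power) auto
    also have "\<dots> \<le> (x / 2) ^ k"
    proof (rule power_mono)
      \<comment> \<open>The additive 4 in \<open>A_factor\<close> ensures \<open>A > 4\<close>,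
        which keeps the base of the count at \<open>exp 1 * t\<close>, half of
        \<open>x\<close>.\<close>
      have "4 * t / A \<le> t" using A t by (simp add: field_simps)
      then have "exp 1 * (4 * t / A) \<le> exp 1 * t" by (rule mult_left_mono) simp
      then show "exp 1 * (4 * t / A) \<le> x / 2" by (simp add: x_def)
    qed (use A t in simp)
    finally have card_le: "real (card {T. T \<in> \<T> \<and> card T = k}) \<le> (x / 2) ^ k" .
    have "(\<Sum>T | T \<in> \<T> \<and> card T = k. (1 - p) ^ card (E T))
        \<le> (\<Sum>T | T \<in> \<T> \<and> card T = k. (1 / x) ^ Suc k)"
    proof (rule sum_mono)
      fix T assume "T \<in> {T. T \<in> \<T> \<and> card T = k}"
      then show "(1 - p) ^ card (E T) \<le> (1 / x) ^ Suc k"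
        using power_deleted_le[of "1 - p" x L d k "card (E T)"] p x L_def d(1) True
        by (auto simp: \<T>_def)
    qed
    also have "\<dots> \<le> (x / 2) ^ k * (1 / x) ^ Suc k"
      using mult_right_mono[OF card_le, of "(1 / x) ^ Suc k"] x by simp
    also have "\<dots> = (1 / 2) ^ k / x" using x by (simp add: power_divide field_simps)
    finally show ?thesis .
  qed
  have "measure_pmf.prob (random_subgraph G p) {X. \<exists>S\<in>independent_sets X. A \<le> sum w S} =
      measure_pmf.prob ?M {keep. \<exists>S\<in>independent_sets (?X keep). A \<le> sum w S}"
    unfolding random_subgraph_def by (simp add: vimage_def)
  also have "\<dots> \<le> measure_pmf.prob ?M (\<Union>T\<in>\<T>. {keep. \<forall>e\<in>E T. \<not> keep e})"
    by (rule measure_pmf.finite_measure_mono[OF sub]) simp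
  also have "\<dots> \<le> (\<Sum>T\<in>\<T>. measure_pmf.prob ?M {keep. \<forall>e\<in>E T. \<not> keep e})"
    by (rule measure_pmf.finite_measure_subadditive_finite) (use fin\<T> in auto)
  also have "\<dots> = (\<Sum>T\<in>\<T>. (1 - p) ^ card (E T))"
    using p by (intro sum.cong prob_all_deleted[OF finE] refl) (auto simp: E_def)
  also have "\<dots> = (\<Sum>k\<in>{1..n}. \<Sum>T | T \<in> \<T> \<and> card T = k. (1 - p) ^ card (E T))"
  proof (rule sum.group[symmetric, OF fin\<T>])
    have "card T \<le> n" if "T \<subseteq> {..<n}" for T using card_mono[OF _ that] by simp
    then show "card ` \<T> \<subseteq> {1..n}" by (auto simp: \<T>_def)
  qed simp
  also have "\<dots> \<le> (\<Sum>k\<in>{1..n}. (1 / 2) ^ k / x)" by (intro sum_mono level)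
  also have "\<dots> = (\<Sum>k\<in>{1..n}. (1 / 2) ^ k) / x" by (simp add: sum_divide_distrib)
  also have "\<dots> \<le> 1 / x" using sum_half_powers_le x by (intro divide_right_mono) auto
  also have "\<dots> \<le> 1 / (2 * t)"
  proof -
    have "1 * (2 * t) \<le> exp 1 * (2 * t)" using t by (intro mult_right_mono) auto
    then show ?thesis using t by (intro divide_left_mono) (auto simp: x_def)
  qed
  finally show ?thesis unfolding A_def .
qed

section \<open>Short-cycle cost\<close>

text \<open>Weak duality by double counting the products \<open>w v * y I\<close> over pairs with
  \<open>v \<in> I\<close>, for a colouring \<open>y\<close>.\<close>

lemma weight_le_chi_f:
  assumes X: "fin_simple_graph X" and a: "0 \<le> a" and nonneg: "\<And>v. 0 \<le> w v"
    and le: "\<And>I. I \<in> independent_sets X \<Longrightarrow> sum w I \<le> a"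
  shows "sum w (verts X) \<le> a * chi_f X"
proof (rule le_mult_chi_f[OF X a])
  fix y assume y: "fractional_colouring X y"
  have fin: "finite (independent_sets X)" and finV: "finite (verts X)"
    using finite_independent_sets[OF X] X by (auto simp: fin_simple_graph_def)
  have "sum w (verts X) \<le> (\<Sum>v\<in>verts X. \<Sum>I | I \<in> independent_sets X \<and> v \<in> I. w v * y I)"
  proof (rule sum_mono)
    fix v assume "v \<in> verts X"
    then have "1 \<le> (\<Sum>I | I \<in> independent_sets X \<and> v \<in> I. y I)"
      using y by (auto simp: fractional_colouring_def)
    from mult_left_mono[OF this nonneg[of v]]
    show "w v \<le> (\<Sum>I | I \<in> independent_sets X \<and> v \<in> I. w v * y I)"
      by (simp add: sum_distrib_left)
  qed
  also have "\<dots> = (\<Sum>I\<in>independent_sets X. \<Sum>v | v \<in> verts X \<and> v \<in> I. w v * y I)"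
    by (rule sum.swap_restrict[OF finV fin])
  also have "\<dots> = (\<Sum>I\<in>independent_sets X. sum w I * y I)"
  proof (rule sum.cong[OF refl])
    fix I assume "I \<in> independent_sets X"
    then have "{v. v \<in> verts X \<and> v \<in> I} = I" using independent_setsD by blast
    then show "(\<Sum>v | v \<in> verts X \<and> v \<in> I. w v * y I) = sum w I * y I"
      by (simp add: sum_distrib_right)
  qed
  also have "\<dots> \<le> (\<Sum>I\<in>independent_sets X. a * y I)"
    using y le by (intro sum_mono mult_right_mono) (auto simp: fractional_colouring_def)
  finally show "sum w (verts X) \<le> a * (\<Sum>I\<in>independent_sets X. y I)"
    by (simp add: sum_distrib_left)
qed

section \<open>Extremal values over finitely many subgraphs and edge sets\<close>

lemma finite_subgraphs:
  assumes G: "fin_simple_graph G"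
  shows "finite {H. subgraph H G}"
proof -
  have "finite (verts G)" using G by (simp add: fin_simple_graph_def)
  moreover have "edges G \<subseteq> Pow (verts G)" using G by (auto simp: fin_simple_graph_def)
  ultimately have "finite (Pow (verts G) \<times> Pow (edges G))" by (simp add: finite_subset)
  moreover have "{H. subgraph H G} \<subseteq> (\<lambda>(V, E). Graph V E) ` (Pow (verts G) \<times> Pow (edges G))"
  proof clarify
    fix H assume "subgraph H G"
    then show "H \<in> (\<lambda>(V, E). Graph V E) ` (Pow (verts G) \<times> Pow (edges G))"
      by (intro image_eqI[of _ _ "(verts H, edges H)"]) (auto simp: subgraph_def)
  qed
  ultimately show ?thesis by (rule finite_surj)
qed

lemma chi_f_le_h_f:
  assumes "fin_simple_graph G" "subgraph H G" "enat r \<le> girth H"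
  shows "chi_f H \<le> h_f r G"
  unfolding h_f_def
proof (rule Max_ge)
  have "{chi_f H | H. subgraph H G \<and> enat r \<le> girth H} \<subseteq> chi_f ` {H. subgraph H G}" by blast
  then show "finite {chi_f H | H. subgraph H G \<and> enat r \<le> girth H}"
    using finite_subgraphs[OF assms(1)] by (rule finite_surj[rotated])
qed (use assms in blast)

lemma girth_edgeless: "edges X = {} \<Longrightarrow> girth X = \<infinity>"
proof -
  assume X: "edges X = {}"
  have "\<not> is_cycle X c" for c
  proof
    assume "is_cycle X c"
    then have "0 < length c" "\<forall>i<length c. {c ! i, c ! (Suc i mod length c)} \<in> edges X"
      by (auto simp: is_cycle_def)
    then show False using X by blast
  qed
  then show ?thesis by (simp add: girth_def Inf_enat_def)
qed

lemma h_f_nonneg: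
  assumes "fin_simple_graph G"
  shows "0 \<le> h_f r G"
proof -
  have H: "fin_simple_graph (Graph {} {})" by (simp add: fin_simple_graph_def)
  have "0 \<le> chi_f (Graph {} {} :: 'a graph)" by (rule chi_f_nonneg[OF H])
  also have "\<dots> \<le> h_f r G"
    by (rule chi_f_le_h_f[OF assms]) (use H in \<open>simp_all add: subgraph_def girth_edgeless\<close>)
  finally show ?thesis .
qed

text \<open>Finitely many edge sets compete, and deleting all edges is always admissible, so the
  minimum is taken over a finite nonempty set.\<close>

lemma short_cycle_cost_attained:
  assumes X: "fin_simple_graph X"
  shows "\<exists>F\<subseteq>edges X. enat r \<le> girth (delete_edges X F) \<and>
    chi_f (Graph (verts X) F) = short_cycle_cost r X"
proof -
  let ?C = "{chi_f (Graph (verts X) F) | F. F \<subseteq> edges X \<and> enat r \<le> girth (delete_edges X F)}"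
  have "finite (edges X)"
    using X by (auto simp: fin_simple_graph_def intro: finite_subset[of _ "Pow (verts X)"])
  then have "finite ?C"
    by (intro finite_surj[of "Pow (edges X)" ?C "\<lambda>F. chi_f (Graph (verts X) F)"]) auto
  moreover have "enat r \<le> girth (delete_edges X (edges X))"
    by (subst girth_edgeless) (auto simp: delete_edges_def)
  then have "?C \<noteq> {}" by blast
  ultimately have "Min ?C \<in> ?C" by (rule Min_in)
  then show ?thesis unfolding short_cycle_cost_def by auto
qed

text \<open>For an optimal \<open>F\<close>, what remains after deletion is a subgraph of
  \<open>G\<close> of girth at least \<open>r\<close>, and \<open>F\<close> itself carries the
  cost.\<close>

lemma chi_f_le_cost_mult_h_f:
  assumes G: "fin_simple_graph G" and X: "subgraph X G"
  shows "chi_f X \<le> h_f r G * short_cycle_cost r X"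
proof -
  have X': "fin_simple_graph X" using X by (simp add: subgraph_def)
  obtain F where F: "F \<subseteq> edges X" "enat r \<le> girth (delete_edges X F)"
      "chi_f (Graph (verts X) F) = short_cycle_cost r X"
    using short_cycle_cost_attained[OF X'] by blast
  have "subgraph (delete_edges X F) G"
    using X fin_simple_graph_delete[OF X'] by (auto simp: subgraph_def delete_edges_def)
  then have "chi_f (delete_edges X F) \<le> h_f r G" using chi_f_le_h_f[OF G] F(2) by blast
  then have "chi_f (delete_edges X F) * chi_f (Graph (verts X) F) \<le> h_f r G * chi_f (Graph (verts X) F)"
    by (rule mult_right_mono) (rule chi_f_nonneg[OF fin_simple_graph_spanning[OF X' F(1)]])
  with chi_f_le_mult[OF X' F(1)] show ?thesis by (simp add: F(3))
qed

section \<open>From one thinned graph to the asymptotic dichotomy\<close>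

lemma random_subgraph_support:
  assumes "fin_simple_graph G" "X \<in> set_pmf (random_subgraph G p)"
  shows "subgraph X G" "verts X = verts G"
  using assms by (fastforce simp: random_subgraph_def subgraph_def fin_simple_graph_def)+

lemma h_f_lower_bound:
  assumes G: "fin_simple_graph G" and p: "0 < p" "p < 1" and R: "1 \<le> R"
    and prob: "1 / (2 * chi_f G) < measure_pmf.prob (random_subgraph G p) {X. short_cycle_cost r X \<le> R}"
  shows "chi_f G / (R * A_factor (chi_f G) p) \<le> h_f r G"
\<comment> \<open>Without vertices \<open>chi_f G = 0\<close> and the bound is trivial; otherwise
  \<open>chi_f G\<close> is at least 1, as the probability estimate needs.\<close>
proof (cases "verts G = {}")
  case True
  then show ?thesis using chi_f_empty[OF G] h_f_nonneg[OF G] by simp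
next
  case False
  define t where "t = chi_f G"
  have t: "1 \<le> t" using False chi_f_ge_1[OF G] by (auto simp: t_def)
  define A where "A = A_factor t p"
  have A: "4 < A" using A_factor_gt[OF t p] by (simp add: A_def)
  \<comment> \<open>Weights of total \<open>s\<close> are available only strictly below
    \<open>t\<close>, so the bound is proved for all such \<open>s\<close> and then extended to
    \<open>t\<close>.\<close>
  have "s \<le> R * A * h_f r G" if s: "0 < s" "s < t" for s
  proof -
    obtain w where w: "\<And>v. 0 \<le> w v" "sum w (verts G) = s"
        "\<And>I. I \<in> independent_sets G \<Longrightarrow> sum w I \<le> 1"
      using fractional_clique[OF G s(1)] s(2) unfolding t_def by blast
    let ?M = "random_subgraph G p"
    let ?bad = "{X. \<exists>S\<in>independent_sets X. A \<le> sum w S}"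
    have "measure_pmf.prob ?M ?bad \<le> 1 / (2 * t)"
      unfolding A_def by (rule prob_heavy_independent_le[OF G p t]) (use w s in auto)
    also have "\<dots> < measure_pmf.prob ?M {X. short_cycle_cost r X \<le> R}"
      using prob by (simp add: t_def)
    finally have lt: "measure_pmf.prob ?M ?bad < measure_pmf.prob ?M {X. short_cycle_cost r X \<le> R}" .
    \<comment> \<open>The cheap event is strictly more probable than the bad one, so some outcome in
      the support is cheap and not bad.\<close>
    have "\<exists>X\<in>set_pmf ?M. short_cycle_cost r X \<le> R \<and> X \<notin> ?bad"
    proof (rule ccontr)
      assume "\<not> ?thesis"
      then have "{X. short_cycle_cost r X \<le> R} \<inter> set_pmf ?M \<subseteq> ?bad" by blast
      then have "measure_pmf.prob ?M ({X. short_cycle_cost r X \<le> R} \<inter> set_pmf ?M) \<le> measure_pmf.prob ?M ?bad"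
        by (rule measure_pmf.finite_measure_mono) simp
      with lt show False by (simp add: measure_Int_set_pmf)
    qed
    then obtain X where X: "X \<in> set_pmf ?M" "short_cycle_cost r X \<le> R" "X \<notin> ?bad" by blast
    have XG: "subgraph X G" "verts X = verts G" using random_subgraph_support[OF G X(1)] by auto
    have "s \<le> A * chi_f X"
      using weight_le_chi_f[of X A w] XG X(3) w(1,2) A
      by (auto simp: subgraph_def not_le intro: less_imp_le)
    also have "\<dots> \<le> A * (h_f r G * R)"
    proof (rule mult_left_mono)
      have "chi_f X \<le> h_f r G * short_cycle_cost r X" by (rule chi_f_le_cost_mult_h_f[OF G XG(1)])
      also have "\<dots> \<le> h_f r G * R" by (rule mult_left_mono[OF X(2) h_f_nonneg[OF G]])
      finally show "chi_f X \<le> h_f r G * R" .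
    qed (use A in simp)
    finally show ?thesis by (simp add: mult_ac)
  qed
  then have "t \<le> R * A * h_f r G" using dense_le_bounded[of 0 t] t by auto
  then show ?thesis
    using A R unfolding t_def[symmetric] A_def[symmetric] by (simp add: pos_divide_le_eq mult.commute)
qed

text \<open>If the limsup lies below a real \<open>B\<close>, then eventually \<open>h_f\<close> is
  smaller than \<open>t / (R * A)\<close>, so the contrapositive of \<open>h_f_lower_bound\<close>
  bounds the probability.\<close>

lemma limsup_h_f_or_costly:
  fixes G :: "nat \<Rightarrow> 'a graph" and p R :: "nat \<Rightarrow> real"
  assumes G: "\<And>n. fin_simple_graph (G n)"
    and t_lim: "filterlim (\<lambda>n. chi_f (G n)) at_top sequentially"
    and p: "\<And>n. 0 < p n \<and> p n < 1" and R: "\<And>n. R n \<ge> 1"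
    and small: "(\<lambda>n. R n * A_factor (chi_f (G n)) (p n)) \<in> o(\<lambda>n. chi_f (G n))"
  shows "limsup (\<lambda>n. ereal (h_f r (G n))) = \<infinity> \<or>
      (\<forall>\<^sub>F n in sequentially.
         measure_pmf.prob (random_subgraph (G n) (p n)) {X. short_cycle_cost r X \<le> R n}
           \<le> 1 / (2 * chi_f (G n)))"
proof (rule disjCI)
  let ?P = "\<lambda>n. measure_pmf.prob (random_subgraph (G n) (p n)) {X. short_cycle_cost r X \<le> R n}
    \<le> 1 / (2 * chi_f (G n))"
  assume freq: "\<not> (\<forall>\<^sub>F n in sequentially. ?P n)"
  show "limsup (\<lambda>n. ereal (h_f r (G n))) = \<infinity>"
  proof (rule ereal_top)
    fix B
    show "ereal B \<le> limsup (\<lambda>n. ereal (h_f r (G n)))"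
    proof (rule ccontr)
      assume "\<not> ?thesis"
      then have "\<forall>\<^sub>F n in sequentially. ereal (h_f r (G n)) < ereal B"
        by (intro Limsup_lessD) (simp add: not_le)
      moreover have "\<forall>\<^sub>F n in sequentially. 1 \<le> chi_f (G n)"
        using t_lim by (simp add: filterlim_at_top)
      \<comment> \<open>The constant makes the quotient at least \<open>\<bar>B\<bar> + 1\<close>,
        which exceeds \<open>B\<close> and is positive whatever the sign of
        \<open>B\<close>.\<close>
      moreover have "\<forall>\<^sub>F n in sequentially. norm (R n * A_factor (chi_f (G n)) (p n))
          \<le> 1 / (\<bar>B\<bar> + 1) * norm (chi_f (G n))"
        by (rule landau_o.smallD[OF small]) simp
      ultimately have "\<forall>\<^sub>F n in sequentially. ?P n"
      proof eventually_elim
        case (elim n)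
        define a where "a = R n * A_factor (chi_f (G n)) (p n)"
        have "0 < A_factor (chi_f (G n)) (p n)" using A_factor_gt[OF elim(2)] p[of n] by fastforce
        then have a: "0 < a" using R[of n] by (simp add: a_def)
        have "a \<le> 1 / (\<bar>B\<bar> + 1) * chi_f (G n)" using elim(2,3) a unfolding a_def[symmetric] by simp
        then have "\<bar>B\<bar> + 1 \<le> chi_f (G n) / a" using a by (simp add: field_simps)
        with elim(1) have "h_f r (G n) < chi_f (G n) / a" by simp
        then show ?case
          using h_f_lower_bound[OF G, of "p n" "R n" n r] p R unfolding a_def by (meson not_le)
      qed
      with freq show False by contradiction
    qed
  qed
qed

theorem theorem10p34:
  fixes r :: nat and G :: "nat \<Rightarrow> 'a graph" and t p R :: "nat \<Rightarrow> real"
  assumes r: "r \<ge> 5"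
    and G: "\<And>n. fin_simple_graph (G n)"
    and t: "\<And>n. t n = chi_f (G n)"
    and t_lim: "filterlim t at_top sequentially"
    and p: "\<And>n. 0 < p n \<and> p n < 1"
    and R: "\<And>n. R n \<ge> 1"
    and small: "(\<lambda>n. R n * A_factor (t n) (p n)) \<in> o(t)"
  shows
    "(limsup (\<lambda>n. ereal (h_f r (G n))) = \<infinity> \<or>
      (\<forall>\<^sub>F n in sequentially.
         measure_pmf.prob (random_subgraph (G n) (p n)) {X. short_cycle_cost r X \<le> R n}
           \<le> 1 / (2 * t n)))
     \<and>
     (\<forall>n. measure_pmf.prob (random_subgraph (G n) (p n)) {X. short_cycle_cost r X \<le> R n}
            > 1 / (2 * t n) \<longrightarrow>
          h_f r (G n) \<ge> t n / (R n * A_factor (t n) (p n)))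
     \<and>
     (bounded (range (\<lambda>n. h_f r (G n))) \<longrightarrow>
       (\<forall>q S :: nat \<Rightarrow> real.
          (\<forall>n. 0 < q n \<and> q n < 1 \<and> S n \<ge> 1) \<and> (\<lambda>n. S n * A_factor (t n) (q n)) \<in> o(t) \<longrightarrow>
          (\<forall>\<^sub>F n in sequentially.
             measure_pmf.prob (random_subgraph (G n) (q n)) {X. short_cycle_cost r X > S n}
               \<ge> 1 - 1 / (2 * t n))))"
proof -
  have t': "t = (\<lambda>n. chi_f (G n))" using t by blast
  \<comment> \<open>Stated for arbitrary \<open>q\<close> and \<open>S\<close>, since the last claim
    ranges over all useful thinnings and not just the given one.\<close>
  have costly: "limsup (\<lambda>n. ereal (h_f r (G n))) = \<infinity> \<or>
      (\<forall>\<^sub>F n in sequentially.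
         measure_pmf.prob (random_subgraph (G n) (q n)) {X. short_cycle_cost r X \<le> S n} \<le> 1 / (2 * t n))"
    if "\<And>n. 0 < q n \<and> q n < 1" "\<And>n. 1 \<le> S n" "(\<lambda>n. S n * A_factor (t n) (q n)) \<in> o(t)"
    for q S :: "nat \<Rightarrow> real"
    using limsup_h_f_or_costly[where G = G and p = q and R = S and r = r] G t_lim that unfolding t' by simp
  have large: "\<forall>\<^sub>F n in sequentially.
      measure_pmf.prob (random_subgraph (G n) (q n)) {X. short_cycle_cost r X > S n} \<ge> 1 - 1 / (2 * t n)"
    if bdd: "bounded (range (\<lambda>n. h_f r (G n)))" and q: "\<forall>n. 0 < q n \<and> q n < 1 \<and> S n \<ge> 1"
      and o: "(\<lambda>n. S n * A_factor (t n) (q n)) \<in> o(t)" for q S :: "nat \<Rightarrow> real"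
  proof -
    obtain B where "\<And>n. \<bar>h_f r (G n)\<bar> \<le> B" using bdd by (auto simp: bounded_iff)
    then have "\<And>n. h_f r (G n) \<le> B" by (meson abs_le_D1)
    \<comment> \<open>A uniform bound rules out the first alternative of \<open>costly\<close>;
      taking complements then gives the claim.\<close>
    then have "limsup (\<lambda>n. ereal (h_f r (G n))) \<le> ereal B" by (intro Limsup_bounded) auto
    then have "limsup (\<lambda>n. ereal (h_f r (G n))) \<noteq> \<infinity>" by auto
    then have "\<forall>\<^sub>F n in sequentially.
        measure_pmf.prob (random_subgraph (G n) (q n)) {X. short_cycle_cost r X \<le> S n} \<le> 1 / (2 * t n)"
      using costly[of q S] q o by simp
    then show ?thesis
    proof eventually_elim
      case (elim n)
      have compl: "{X. short_cycle_cost r X > S n} = UNIV - {X. short_cycle_cost r X \<le> S n}" by auto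
      show ?case
        unfolding compl
        using elim measure_pmf.prob_compl[of "{X. short_cycle_cost r X \<le> S n}" "random_subgraph (G n) (q n)"]
        by simp
    qed
  qed
  have lower: "h_f r (G n) \<ge> t n / (R n * A_factor (t n) (p n))"
    if "measure_pmf.prob (random_subgraph (G n) (p n)) {X. short_cycle_cost r X \<le> R n} > 1 / (2 * t n)" for n
    using h_f_lower_bound[OF G, of "p n" "R n" n r] p R that by (simp add: t)
  show ?thesis using costly[OF p R small] lower large by blast
qed

end
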